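(* There exists a universal constant $\tilde c>0$ such that, for the synchronous Huber-contaminated observation model described in the context with $T$ data sets, discount factor $\gamma\in(0,1)$, corruption probability $\varepsilon\in[0,1/2)$ and noise level $\bar\sigma$, $$\inf_{\hat Q_T}\ \sup_{Q^*\in\mathcal H(\varepsilon,\bar\sigma,\mathcal Q)}\ \mathbb P\left(\|\hat Q_T-Q^*\|_\infty\ge\frac{\tilde c\,\bar\sigma\sqrt\varepsilon}{1-\gamma}\right)\ge\frac14,$$ where the infimum is over all estimators $\hat Q_T$ of $Q^*$, i.e. all measurable functions of the $T$ data sets $\tilde D_1,\dots,\tilde D_T$.
   Context: A discounted MDP consists of a finite state space $\mathcal S$, a finite action space $\mathcal A$, transition kernels $\mathcal P(\cdot|s,a)$, reward distributions $\mathcal R(s,a)$ on $\mathbb R$ with mean $R(s,a)$, and a discount factor $\gamma\in(0,1)$. Its optimal state-action value function $Q^*$ is the unique fixed point of $(\mathcal TQ)(s,a)=R(s,a)+\gamma\,\mathbb E_{s'\sim\mathcal P(\cdot|s,a)}[\max_{a'}Q(s',a')]$. Synchronous Huber contamination model: at each time $t=1,\dots,T$, independently of the past, a biased coin with probability of heads $1-\varepsilon$ is tossed. If it lands heads, then for each $(s,a)\in\mathcal S\times\mathcal A$ the learner observes $y_t(s,a)\sim\mathcal R(s,a)$; if it lands tails, then for each $(s,a)$, $y_t(s,a)\sim\mathcal Q$, where $\mathcal Q$ is an arbitrary adversarial distribution. The learner also observes next-state samples $s_t(s,a)\sim\mathcal P(\cdot|s,a)$. The data sets $\tilde D_t=\{s_t(s,a),y_t(s,a)\}_{(s,a)\in\mathcal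 S\times\mathcal A}$, $t=1,\dots,T$, are independent. $\mathcal H(\varepsilon,\bar\sigma,\mathcal Q)$ denotes collectively the set of all MDPs and observation models with finite state and action spaces (and the given discount factor $\gamma$) whose true reward distributions have bounded means and variance at most $\bar\sigma^2$, and whose observed rewards are generated by the synchronous Huber contamination model above. The supremum thus ranges over MDPs and over the arbitrary adversarial distribution $\mathcal Q$. Writing $Q^*\in\mathcal H(\varepsilon,\bar\sigma,\mathcal Q)$ means that $Q^*$ is the optimal state-action value function of an MDP in this class, and the probability is over data generated by the corresponding observation model. *)

theory Defs
  imports "HOL-Probability.Probability"
begin

section \<open>Discounted MDPs\<close>

text \<open>The cardinalities of the state and action spaces vary inside a single statement, so both are
  finite subsets of \<^typ>\<open>nat\<close> instead of types. The fields \<open>transition\<close> and \<open>rewards\<close> matter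
  only on \<open>states \<times> actions\<close>. The discount factor is a separate argument.\<close>

record mdp =
  states :: "nat set"
  actions :: "nat set"
  transition :: "nat \<Rightarrow> nat \<Rightarrow> nat pmf"
  rewards :: "nat \<Rightarrow> nat \<Rightarrow> real measure"

abbreviation state_actions :: "mdp \<Rightarrow> (nat \<times> nat) set" where
  "state_actions M \<equiv> states M \<times> actions M"

definition finite_mdp :: "mdp \<Rightarrow> bool" where
  "finite_mdp M \<longleftrightarrow>
     finite (states M) \<and> states M \<noteq> {} \<and> finite (actions M) \<and> actions M \<noteq> {} \<and>
     (\<forall>s\<in>states M. \<forall>a\<in>actions M.
        set_pmf (transition M s a) \<subseteq> states M \<and> real_distribution (rewards M s a))"

definition mean_reward :: "mdp \<Rightarrow> nat \<Rightarrow> nat \<Rightarrow> real" where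
  "mean_reward M s a = (\<integral>r. r \<partial>rewards M s a)"

definition bellman :: "real \<Rightarrow> mdp \<Rightarrow> (nat \<times> nat \<Rightarrow> real) \<Rightarrow> nat \<times> nat \<Rightarrow> real" where
  "bellman \<gamma> M Q = (\<lambda>(s, a)\<in>state_actions M.
     mean_reward M s a +
     \<gamma> * measure_pmf.expectation (transition M s a) (\<lambda>s'. MAX a'\<in>actions M. Q (s', a')))"

text \<open>\<^const>\<open>bellman\<close> returns functions that are \<^const>\<open>undefined\<close> off \<open>states \<times> actions\<close>, so a
  fixed point is determined there too. Existence and uniqueness are proved below.\<close>

definition optimal_Q :: "real \<Rightarrow> mdp \<Rightarrow> nat \<times> nat \<Rightarrow> real" where
  "optimal_Q \<gamma> M = (THE Q. bellman \<gamma> M Q = Q)"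

definition sup_dist :: "mdp \<Rightarrow> (nat \<times> nat \<Rightarrow> real) \<Rightarrow> (nat \<times> nat \<Rightarrow> real) \<Rightarrow> real" where
  "sup_dist M Q Q' = (MAX x\<in>state_actions M. \<bar>Q x - Q' x\<bar>)"

lemma abs_Max_diff_le:
  fixes f g :: "'a \<Rightarrow> real"
  assumes "finite A" "A \<noteq> {}" and le: "\<And>a. a \<in> A \<Longrightarrow> \<bar>f a - g a\<bar> \<le> d"
  shows "\<bar>(MAX a\<in>A. f a) - (MAX a\<in>A. g a)\<bar> \<le> d"
proof -
  have *: "(MAX a\<in>A. p a) \<le> (MAX a\<in>A. q a) + d"
    if pq: "\<And>a. a \<in> A \<Longrightarrow> p a \<le> q a + d" for p q :: "'a \<Rightarrow> real"
  proof -
    have "p a \<le> (MAX a\<in>A. q a) + d" if "a \<in> A" for a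
      using pq[OF that] Max_ge[OF finite_imageI[OF assms(1)] imageI[OF that], of q] by linarith
    then show ?thesis
      using assms(1,2) by (subst Max_le_iff) auto
  qed
  have "f a \<le> g a + d" "g a \<le> f a + d" if "a \<in> A" for a
    using le[OF that] by linarith+
  then show ?thesis
    using *[of f g] *[of g f] by fastforce
qed

lemma bellman_contraction:
  assumes M: "finite_mdp M" and g: "0 \<le> \<gamma>" and x: "x \<in> state_actions M"
    and d: "\<And>y. y \<in> state_actions M \<Longrightarrow> \<bar>Q y - Q' y\<bar> \<le> d"
  shows "\<bar>bellman \<gamma> M Q x - bellman \<gamma> M Q' x\<bar> \<le> \<gamma> * d"
proof -
  obtain s a where x_eq: "x = (s, a)" and sa: "s \<in> states M" "a \<in> actions M"
    using x by auto
  let ?v = "\<lambda>Q s'. MAX a'\<in>actions M. Q (s', a')"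
  let ?P = "measure_pmf (transition M s a)"
  have sub: "set_pmf (transition M s a) \<subseteq> states M" and fin: "finite (states M)"
    and A: "finite (actions M)" "actions M \<noteq> {}"
    using M sa by (auto simp: finite_mdp_def)
  have int: "integrable ?P f" for f :: "nat \<Rightarrow> real"
    using finite_subset[OF sub fin] by (rule integrable_measure_pmf_finite)
  have "\<bar>?v Q s' - ?v Q' s'\<bar> \<le> d" if "s' \<in> states M" for s'
    using A d that by (intro abs_Max_diff_le) auto
  then have "(\<integral>s'. \<bar>?v Q s' - ?v Q' s'\<bar> \<partial>?P) \<le> (\<integral>s'. d \<partial>?P)"
    using sub by (intro integral_mono_AE int) (auto simp: AE_measure_pmf_iff)
  then have "\<bar>(\<integral>s'. ?v Q s' \<partial>?P) - (\<integral>s'. ?v Q' s' \<partial>?P)\<bar> \<le> d"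
    using integral_abs_bound[of ?P "\<lambda>s'. ?v Q s' - ?v Q' s'"]
    by (simp add: int)
  then show ?thesis
    using g sa by (simp add: bellman_def x_eq abs_mult mult_left_mono flip: right_diff_distrib)
qed

lemma bellman_ex1_fixpoint:
  assumes M: "finite_mdp M" and g: "0 \<le> \<gamma>" "\<gamma> < 1"
  shows "\<exists>!Q. bellman \<gamma> M Q = Q"
proof (rule ex_ex1I)
  let ?SA = "state_actions M"
  have fin: "finite ?SA" and ne: "?SA \<noteq> {}"
    using M by (auto simp: finite_mdp_def)
  define F where "F h = Bcontfun (\<lambda>n. if of_discrete n \<in> ?SA
      then bellman \<gamma> M (\<lambda>x. apply_bcontfun h (discrete x)) (of_discrete n) else 0)"
    for h :: "(nat \<times> nat) discrete \<Rightarrow>\<^sub>C real"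
  have bc: "(\<lambda>n. if of_discrete n \<in> ?SA then f (of_discrete n) else 0) \<in> bcontfun"
    for f :: "nat \<times> nat \<Rightarrow> real"
  proof -
    have "range (\<lambda>n. if of_discrete n \<in> ?SA then f (of_discrete n) else 0)
        \<subseteq> insert 0 (f ` ?SA)" by auto
    then have "finite (range (\<lambda>n. if of_discrete n \<in> ?SA then f (of_discrete n) else 0))"
      by (rule finite_subset) (use fin in simp)
    then show ?thesis
      by (auto simp: bcontfun_def continuous_on_open_invariant open_discrete intro: finite_imp_bounded)
  qed
  have F_apply: "apply_bcontfun (F h) n = (if of_discrete n \<in> ?SA
      then bellman \<gamma> M (\<lambda>x. apply_bcontfun h (discrete x)) (of_discrete n) else 0)" for h n
    unfolding F_def by (subst Bcontfun_inverse[OF bc]) simp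
  have F_contr: "dist (F h) (F h') \<le> \<gamma> * dist h h'" for h h'
  proof (rule dist_bound)
    fix n
    have "\<bar>apply_bcontfun h m - apply_bcontfun h' m\<bar> \<le> dist h h'" for m
      using dist_bounded[of h m h'] by (simp add: dist_real_def)
    then show "dist (apply_bcontfun (F h) n) (apply_bcontfun (F h') n) \<le> \<gamma> * dist h h'"
      using g(1) by (auto simp: F_apply dist_real_def intro!: bellman_contraction[OF M])
  qed
  obtain h where h: "F h = h"
    using banach_fix_type[of \<gamma> F] g F_contr by blast
  define q where "q = (\<lambda>x. apply_bcontfun h (discrete x))"
  have "bellman \<gamma> M q x = q x" if "x \<in> ?SA" for x
    using F_apply[of h "discrete x"] that h by (simp add: q_def discrete_inverse)
  then have "bellman \<gamma> M (bellman \<gamma> M q) y = bellman \<gamma> M q y" if "y \<in> ?SA" for y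
    using bellman_contraction[OF M g(1) that, of "bellman \<gamma> M q" q 0] by simp
  moreover have "bellman \<gamma> M f y = undefined" if "y \<notin> ?SA" for f y
    using that by (auto simp: bellman_def restrict_def)
  ultimately have "bellman \<gamma> M (bellman \<gamma> M q) = bellman \<gamma> M q"
    by (metis ext)
  then show "\<exists>Q. bellman \<gamma> M Q = Q" by blast
next
  let ?SA = "state_actions M"
  fix Q Q' assume Q: "bellman \<gamma> M Q = Q" "bellman \<gamma> M Q' = Q'"
  have fin: "finite ?SA" and ne: "?SA \<noteq> {}"
    using M by (auto simp: finite_mdp_def)
  define d where "d = (MAX x\<in>?SA. \<bar>Q x - Q' x\<bar>)"
  have le: "\<bar>Q x - Q' x\<bar> \<le> d" if "x \<in> ?SA" for x
    using that fin unfolding d_def by (intro Max_ge) auto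
  have "d \<in> (\<lambda>x. \<bar>Q x - Q' x\<bar>) ` ?SA"
    unfolding d_def using fin ne by (intro Max_in) auto
  then obtain x where x: "x \<in> ?SA" "d = \<bar>Q x - Q' x\<bar>" by blast
  have "d \<le> \<gamma> * d"
    using bellman_contraction[OF M g(1) x(1), of Q Q' d] le Q x(2) by simp
  moreover have "0 \<le> d"
    using x(2) by simp
  ultimately have "d = 0"
    using g(2) mult_right_mono[of \<gamma> 1 d] by (cases "d = 0") (auto simp: mult_less_cancel_right2)
  show "Q = Q'"
  proof
    fix y
    show "Q y = Q' y"
    proof (cases "y \<in> ?SA")
      case True
      then show ?thesis using le[OF True] \<open>d = 0\<close> by simp
    next
      case False
      then have "bellman \<gamma> M Q y = bellman \<gamma> M Q' y"
        by (auto simp: bellman_def restrict_def)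
      then show ?thesis using Q by simp
    qed
  qed
qed

lemma bellman_optimal_Q:
  assumes "finite_mdp M" "0 \<le> \<gamma>" "\<gamma> < 1"
  shows "bellman \<gamma> M (optimal_Q \<gamma> M) = optimal_Q \<gamma> M"
  unfolding optimal_Q_def by (rule theI'[OF bellman_ex1_fixpoint[OF assms]])

section \<open>Synchronous Huber contamination\<close>

text \<open>A data set maps each state-action pair to its next-state sample and observed reward.\<close>

definition dataset_space :: "nat set \<Rightarrow> nat set \<Rightarrow> (nat \<times> nat \<Rightarrow> nat \<times> real) measure" where
  "dataset_space S A = Pi\<^sub>M (S \<times> A) (\<lambda>_. count_space UNIV \<Otimes>\<^sub>M borel)"

text \<open>A single coin is tossed per time step and shared by all state-action pairs. Given its
  outcome, all next-state and reward samples are drawn independently.\<close>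

definition dataset_law ::
    "real \<Rightarrow> mdp \<Rightarrow> real measure \<Rightarrow> (nat \<times> nat \<Rightarrow> nat \<times> real) measure" where
  "dataset_law \<epsilon> M Adv =
     measure_pmf (bernoulli_pmf (1 - \<epsilon>)) \<bind> (\<lambda>heads.
       Pi\<^sub>M (state_actions M)
         (\<lambda>(s, a). measure_pmf (transition M s a) \<Otimes>\<^sub>M (if heads then rewards M s a else Adv)))"

definition data_law ::
    "nat \<Rightarrow> real \<Rightarrow> mdp \<Rightarrow> real measure \<Rightarrow> (nat \<Rightarrow> nat \<times> nat \<Rightarrow> nat \<times> real) measure" where
  "data_law T \<epsilon> M Adv = Pi\<^sub>M {1..T} (\<lambda>_. dataset_law \<epsilon> M Adv)"

text \<open>The law \<open>Adv\<close> is the one from which corrupted rewards are drawn; no moment of it is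
  required. As the state and action spaces are finite, boundedness of the mean rewards amounts to
  their being finite. The integrability conditions are needed because an integral that does not
  exist has the value 0.\<close>

definition huber_class :: "real \<Rightarrow> (mdp \<times> real measure) set" where
  "huber_class \<sigma> = {(M, Adv). finite_mdp M \<and> real_distribution Adv \<and>
     (\<forall>s\<in>states M. \<forall>a\<in>actions M.
        integrable (rewards M s a) (\<lambda>r. r) \<and>
        integrable (rewards M s a) (\<lambda>r. r\<^sup>2) \<and>
        prob_space.variance (rewards M s a) (\<lambda>r. r) \<le> \<sigma>\<^sup>2)}"

text \<open>Since the state and action spaces are known to the learner and range over all finite spaces,
  an estimator is a family of measurable maps indexed by them.\<close>

definition estimators ::
    "nat \<Rightarrow> (nat set \<Rightarrow> nat set \<Rightarrow> (nat \<Rightarrow> nat \<times> nat \<Rightarrow> nat \<times> real) \<Rightarrow> nat \<times> nat \<Rightarrow> real) set" where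
  "estimators T = {Qhat. \<forall>S A. finite S \<and> S \<noteq> {} \<and> finite A \<and> A \<noteq> {} \<longrightarrow>
     Qhat S A \<in> Pi\<^sub>M {1..T} (\<lambda>_. dataset_space S A) \<rightarrow>\<^sub>M Pi\<^sub>M (S \<times> A) (\<lambda>_. borel)}"

lemma real_distribution_iff: "real_distribution D \<longleftrightarrow> prob_space D \<and> sets D = sets borel"
  by (auto simp: real_distribution_def real_distribution_axioms_def)

lemma sets_huber_data_component:
  assumes "finite_mdp M" "real_distribution Adv"
  shows "sets (Pi\<^sub>M (state_actions M)
      (\<lambda>(s, a). measure_pmf (transition M s a) \<Otimes>\<^sub>M (if heads then rewards M s a else Adv)))
    = sets (dataset_space (states M) (actions M))"
  unfolding dataset_space_def using assms
  by (intro sets_PiM_cong refl)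
    (auto simp: finite_mdp_def real_distribution_iff intro!: sets_pair_measure_cong split: if_splits)

lemma prob_space_huber_data_component:
  assumes "finite_mdp M" "real_distribution Adv"
  shows "prob_space (Pi\<^sub>M (state_actions M)
      (\<lambda>(s, a). measure_pmf (transition M s a) \<Otimes>\<^sub>M (if heads then rewards M s a else Adv)))"
proof (rule prob_space_PiM)
  fix x assume "x \<in> state_actions M"
  then obtain s a where x: "x = (s, a)" "s \<in> states M" "a \<in> actions M" by auto
  let ?R = "if heads then rewards M s a else Adv"
  interpret R: prob_space ?R
    using assms x by (auto simp: finite_mdp_def real_distribution_iff)
  interpret pair_prob_space "measure_pmf (transition M s a)" ?R ..
  show "prob_space (case x of (s, a) \<Rightarrow>
      measure_pmf (transition M s a) \<Otimes>\<^sub>M (if heads then rewards M s a else Adv))"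
    using x(1) prob_space_axioms by simp
qed

lemma
  assumes "finite_mdp M" "real_distribution Adv"
  shows sets_dataset_law: "sets (dataset_law \<epsilon> M Adv) = sets (dataset_space (states M) (actions M))"
    and prob_space_dataset_law: "prob_space (dataset_law \<epsilon> M Adv)"
proof -
  let ?D = "dataset_space (states M) (actions M)"
  let ?K = "\<lambda>heads. Pi\<^sub>M (state_actions M)
      (\<lambda>(s, a). measure_pmf (transition M s a) \<Otimes>\<^sub>M (if heads then rewards M s a else Adv))"
  have K: "?K \<in> measure_pmf (bernoulli_pmf (1 - \<epsilon>)) \<rightarrow>\<^sub>M prob_algebra ?D"
    using sets_huber_data_component[OF assms] prob_space_huber_data_component[OF assms]
    by (auto simp: space_prob_algebra)
  show "sets (dataset_law \<epsilon> M Adv) = sets ?D"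
    unfolding dataset_law_def using sets_huber_data_component[OF assms] by (intro sets_bind) auto
  show "prob_space (dataset_law \<epsilon> M Adv)"
    unfolding dataset_law_def
    by (rule prob_space_bind'[OF _ K])
      (simp add: space_prob_algebra measure_pmf.prob_space_axioms)
qed

lemma error_event_measurable:
  assumes "(M, Adv) \<in> huber_class \<sigma>" and Qhat: "Qhat \<in> estimators T"
  shows "{D \<in> space (data_law T \<epsilon> M Adv). b \<le> sup_dist M (Qhat (states M) (actions M) D) Q}
    \<in> sets (data_law T \<epsilon> M Adv)"
proof -
  have M: "finite_mdp M" "real_distribution Adv"
    using assms(1) by (auto simp: huber_class_def)
  then have fin: "finite (state_actions M)" and ne: "state_actions M \<noteq> {}"
    by (auto simp: finite_mdp_def)
  let ?L = "data_law T \<epsilon> M Adv"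
  have "sets ?L = sets (Pi\<^sub>M {1..T} (\<lambda>_. dataset_space (states M) (actions M)))"
    unfolding data_law_def by (intro sets_PiM_cong refl sets_dataset_law[OF M])
  then have meas: "Qhat (states M) (actions M) \<in> ?L \<rightarrow>\<^sub>M Pi\<^sub>M (state_actions M) (\<lambda>_. borel)"
    using Qhat M(1) by (auto simp: estimators_def finite_mdp_def cong: measurable_cong_sets)
  have "(\<lambda>D. Qhat (states M) (actions M) D x) \<in> borel_measurable ?L" if "x \<in> state_actions M" for x
    using measurable_compose[OF meas measurable_component_singleton[OF that]] .
  then have "{D \<in> space ?L. b \<le> \<bar>Qhat (states M) (actions M) D x - Q x\<bar>} \<in> sets ?L"
    if "x \<in> state_actions M" for x
    using that by measurable
  then have "(\<Union>x\<in>state_actions M. {D \<in> space ?L. b \<le> \<bar>Qhat (states M) (actions M) D x - Q x\<bar>})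
      \<in> sets ?L"
    using fin by (intro sets.finite_UN) auto
  also have "(\<Union>x\<in>state_actions M. {D \<in> space ?L. b \<le> \<bar>Qhat (states M) (actions M) D x - Q x\<bar>})
      = {D \<in> space ?L. b \<le> sup_dist M (Qhat (states M) (actions M) D) Q}"
    using fin ne by (auto simp: sup_dist_def Max_ge_iff)
  finally show ?thesis .
qed

end

theory Submission
  imports Defs
begin

text \<open>Le Cam's two-point method with indistinguishable models. Take a single state and a single
  action and let \<open>B q\<close> be the law that puts mass \<open>q\<close> on \<open>m = \<sigma> / sqrt \<epsilon>\<close> and the rest on \<open>0\<close>.
  True rewards \<open>B 0\<close> corrupted by \<open>B (1 - \<epsilon>)\<close> and true rewards \<open>B \<epsilon>\<close> corrupted by \<open>B 0\<close> both
  give the observed law \<open>B (\<epsilon> * (1 - \<epsilon>))\<close>. The optimal values differ by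
  \<open>m * \<epsilon> / (1 - \<gamma>) = \<sigma> * sqrt \<epsilon> / (1 - \<gamma>)\<close>, so every estimator is off by at least half of this
  in one of the two models with probability at least \<open>1/2\<close>.\<close>

text \<open>As an image of a coin, the law lets equality of observed data laws be reduced to
  equality of pmfs on booleans.\<close>

definition two_point :: "real \<Rightarrow> real \<Rightarrow> real measure" where
  "two_point m q = distr (measure_pmf (bernoulli_pmf q)) borel (\<lambda>b. if b then m else 0)"

definition one_state_mdp :: "real measure \<Rightarrow> mdp" where
  "one_state_mdp R = \<lparr>states = {0}, actions = {0}, transition = (\<lambda>_ _. return_pmf 0),
     rewards = (\<lambda>_ _. R)\<rparr>"

lemma one_state_mdp_simps [simp]:
  "states (one_state_mdp R) = {0}" "actions (one_state_mdp R) = {0}"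
  "transition (one_state_mdp R) s a = return_pmf 0" "rewards (one_state_mdp R) s a = R"
  by (simp_all add: one_state_mdp_def)

lemma real_distribution_two_point: "real_distribution (two_point m q)"
  unfolding real_distribution_iff two_point_def
  by (auto intro!: prob_space.prob_space_distr measure_pmf.prob_space_axioms)

lemma integrable_two_point:
  fixes f :: "real \<Rightarrow> real"
  assumes "f \<in> borel_measurable borel"
  shows "integrable (two_point m q) f"
  unfolding two_point_def using assms
  by (subst integrable_distr_eq) (auto intro!: integrable_measure_pmf_finite)

lemma integral_two_point:
  fixes f :: "real \<Rightarrow> real"
  assumes "f \<in> borel_measurable borel" "0 \<le> q" "q \<le> 1"
  shows "(\<integral>x. f x \<partial>two_point m q) = q * f m + (1 - q) * f 0"
  unfolding two_point_def using assms
  by (subst integral_distr) (auto simp: integral_bernoulli_pmf)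

lemma finite_one_state_mdp:
  assumes "real_distribution R"
  shows "finite_mdp (one_state_mdp R)"
  using assms by (simp add: finite_mdp_def)

text \<open>The mean is \<open>q * m\<close> and the variance is the second moment
  \<open>m\<^sup>2 * q\<close> times \<open>1 - q\<close>, so a bound on the second moment suffices.
  The class puts no moment condition on \<open>Adv\<close>.\<close>

lemma two_point_in_huber_class:
  assumes "0 \<le> q" "q \<le> 1" "m\<^sup>2 * q \<le> \<sigma>\<^sup>2" "real_distribution Adv"
  shows "(one_state_mdp (two_point m q), Adv) \<in> huber_class \<sigma>"
proof -
  have "(\<integral>x. (x - q * m)\<^sup>2 \<partial>two_point m q) = m\<^sup>2 * q * (1 - q)"
    using assms by (subst integral_two_point) (auto simp: power2_eq_square algebra_simps)
  also have "\<dots> \<le> m\<^sup>2 * q"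
    using assms by (simp add: mult_left_le)
  also have "\<dots> \<le> \<sigma>\<^sup>2" by fact
  finally have "prob_space.variance (two_point m q) (\<lambda>r. r) \<le> \<sigma>\<^sup>2"
    using assms by (simp add: integral_two_point)
  then show ?thesis
    using assms finite_one_state_mdp real_distribution_two_point
    by (simp add: huber_class_def integrable_two_point)
qed

text \<open>The Bellman equation becomes a scalar linear equation, since the maximum and the
  expectation run over a single point.\<close>

lemma optimal_Q_one_state:
  assumes "real_distribution R" "0 \<le> \<gamma>" "\<gamma> < 1"
  shows "optimal_Q \<gamma> (one_state_mdp R) (0, 0) = (\<integral>r. r \<partial>R) / (1 - \<gamma>)"
proof -
  let ?Q = "optimal_Q \<gamma> (one_state_mdp R)"
  have "?Q (0, 0) = bellman \<gamma> (one_state_mdp R) ?Q (0, 0)"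
    using assms by (simp add: bellman_optimal_Q finite_one_state_mdp)
  then have "?Q (0, 0) = (\<integral>r. r \<partial>R) + \<gamma> * ?Q (0, 0)"
    by (simp add: bellman_def mean_reward_def)
  then show ?thesis
    using assms by (simp add: field_simps)
qed

lemma sup_dist_one_state:
  "sup_dist (one_state_mdp R) Q Q' = \<bar>Q (0, 0) - Q' (0, 0)\<bar>"
  by (simp add: sup_dist_def)

lemma PiM_two_point:
  "Pi\<^sub>M {(0::nat, 0::nat)} (\<lambda>_. measure_pmf (return_pmf (0::nat)) \<Otimes>\<^sub>M two_point m q) =
     distr (measure_pmf (bernoulli_pmf q)) (dataset_space {0} {0})
       (\<lambda>b. \<lambda>_\<in>{(0, 0)}. (0, if b then m else 0))"
    (is "Pi\<^sub>M ?I (\<lambda>_. ?N) = distr ?B ?D ?g")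
proof -
  interpret T: real_distribution "two_point m q"
    by (rule real_distribution_two_point)
  interpret N: pair_prob_space "measure_pmf (return_pmf (0::nat))" "two_point m q" ..
  interpret product_sigma_finite "\<lambda>_::nat \<times> nat. ?N" ..
  have sets: "sets ?N = sets (count_space UNIV \<Otimes>\<^sub>M borel)"
    by (intro sets_pair_measure_cong) auto
  have g: "?g \<in> ?B \<rightarrow>\<^sub>M ?D"
    by (auto simp: dataset_space_def space_PiM space_pair_measure)
  show ?thesis
  proof (rule PiM_eqI[symmetric])
    show "sets (distr ?B ?D ?g) = sets (Pi\<^sub>M ?I (\<lambda>_. ?N))"
      by (simp add: dataset_space_def, intro sets_PiM_cong refl sets[symmetric])
  next
    fix A :: "nat \<times> nat \<Rightarrow> (nat \<times> real) set"
    assume A: "\<And>i. i \<in> ?I \<Longrightarrow> A i \<in> sets ?N"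
    let ?A = "A (0, 0)"
    have A0: "?A \<in> sets ?N" using A by simp
    have AI: "Pi\<^sub>E ?I A \<in> sets ?D"
      using A sets by (auto simp: dataset_space_def intro!: sets_PiM_I_finite)
    \<comment> \<open>The next state is always 0, so only the section of \<open>?A\<close> at 0
      carries mass.\<close>
    have sl: "Pair 0 -` ?A \<in> sets borel"
      using sets_Pair1[OF A0] by simp
    have "emeasure (distr ?B ?D ?g) (Pi\<^sub>E ?I A) = emeasure ?B {b. (0, if b then m else 0) \<in> ?A}"
      using g AI by (subst emeasure_distr) (auto intro!: arg_cong[where f = "emeasure _"])
    also have "\<dots> = emeasure (two_point m q) (Pair 0 -` ?A)"
      unfolding two_point_def using sl
      by (subst emeasure_distr) (auto intro!: arg_cong[where f = "emeasure _"])
    also have "\<dots> = emeasure ?N ?A"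
      using A0 by (simp add: T.emeasure_pair_measure_alt)
    finally show "emeasure (distr ?B ?D ?g) (Pi\<^sub>E ?I A) = (\<Prod>i\<in>?I. emeasure ?N (A i))"
      by simp
  qed simp
qed

text \<open>The contamination coin and the reward coin merge into one pmf on booleans. The remaining
  kernel is deterministic and independent of \<open>q\<close> and \<open>r\<close>, so two models
  with equal merged coins give the same data.\<close>

lemma dataset_law_two_point:
  "dataset_law \<epsilon> (one_state_mdp (two_point m q)) (two_point m r) =
    measure_pmf (bind_pmf (bernoulli_pmf (1 - \<epsilon>)) (\<lambda>h. bernoulli_pmf (if h then q else r)))
      \<bind> (\<lambda>b. return (dataset_space {0} {0}) (\<lambda>_\<in>{(0, 0)}. (0, if b then m else 0)))"
    (is "_ = measure_pmf (bind_pmf ?C ?K) \<bind> (\<lambda>b. return ?D (?g b))")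
proof -
  have g: "?g \<in> count_space UNIV \<rightarrow>\<^sub>M ?D"
    by (auto simp: dataset_space_def space_PiM space_pair_measure)
  have ret: "(\<lambda>b. return ?D (?g b)) \<in> count_space UNIV \<rightarrow>\<^sub>M subprob_algebra ?D"
    using measurable_compose[OF g return_measurable] .
  have "dataset_law \<epsilon> (one_state_mdp (two_point m q)) (two_point m r) =
      measure_pmf ?C \<bind> (\<lambda>h. distr (measure_pmf (?K h)) ?D ?g)"
    unfolding dataset_law_def PiM_two_point[symmetric]
    by (auto intro!: arg_cong2[where f = bind] arg_cong2[where f = PiM] ext)
  also have "\<dots> = measure_pmf ?C \<bind> (\<lambda>h. measure_pmf (?K h) \<bind> (\<lambda>b. return ?D (?g b)))"
    using g by (simp add: bind_return_distr' comp_def)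
  also have "\<dots> = (measure_pmf ?C \<bind> (\<lambda>h. measure_pmf (?K h))) \<bind> (\<lambda>b. return ?D (?g b))"
    by (rule bind_assoc[where N = "count_space UNIV", symmetric])
      (use ret in \<open>simp_all add: measure_pmf_in_subprob_algebra\<close>)
  finally show ?thesis
    by (simp add: measure_pmf_bind)
qed

text \<open>Both sides give \<open>True\<close> with probability
  \<open>\<epsilon> * (1 - \<epsilon>)\<close>: on the left only after tails, on the right only
  after heads.\<close>

lemma bernoulli_mixture_eq:
  assumes "0 \<le> \<epsilon>" "\<epsilon> \<le> 1"
  shows "bind_pmf (bernoulli_pmf (1 - \<epsilon>)) (\<lambda>h. bernoulli_pmf (if h then 0 else 1 - \<epsilon>)) =
    bind_pmf (bernoulli_pmf (1 - \<epsilon>)) (\<lambda>h. bernoulli_pmf (if h then \<epsilon> else 0))"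
proof (rule pmf_eqI)
  show "pmf (bind_pmf (bernoulli_pmf (1 - \<epsilon>)) (\<lambda>h. bernoulli_pmf (if h then 0 else 1 - \<epsilon>))) b =
    pmf (bind_pmf (bernoulli_pmf (1 - \<epsilon>)) (\<lambda>h. bernoulli_pmf (if h then \<epsilon> else 0))) b" for b
    using assms by (cases b) (simp_all add: pmf_bind algebra_simps)
qed

text \<open>The laws already agree for one data set, hence so do their products; no sample size
  \<open>T\<close> separates the models.\<close>

lemma data_law_indistinguishable:
  assumes "0 \<le> \<epsilon>" "\<epsilon> \<le> 1"
  shows "data_law T \<epsilon> (one_state_mdp (two_point m 0)) (two_point m (1 - \<epsilon>)) =
    data_law T \<epsilon> (one_state_mdp (two_point m \<epsilon>)) (two_point m 0)"
  unfolding data_law_def by (simp add: dataset_law_two_point bernoulli_mixture_eq assms)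

lemma (in prob_space) half_le_emeasure_of_cover:
  assumes "A \<in> events" "B \<in> events" "space M \<subseteq> A \<union> B"
  shows "ennreal (1 / 2) \<le> emeasure M A \<or> ennreal (1 / 2) \<le> emeasure M B"
proof -
  have "1 \<le> prob (A \<union> B)"
    using assms finite_measure_mono[of "space M" "A \<union> B"] by (simp add: prob_space)
  also have "\<dots> \<le> prob A + prob B"
    using assms by (intro measure_Un_le) auto
  finally have "1 / 2 \<le> prob A \<or> 1 / 2 \<le> prob B" by linarith
  then show ?thesis
    by (metis emeasure_eq_measure ennreal_leI)
qed

theorem theorem3:
  shows "\<exists>c::real. c > 0 \<and>
    (\<forall>(T::nat) (\<gamma>::real) (\<epsilon>::real) (\<sigma>::real).
       1 \<le> T \<longrightarrow> 0 < \<gamma> \<longrightarrow> \<gamma> < 1 \<longrightarrow> 0 \<le> \<epsilon> \<longrightarrow> \<epsilon> < 1 / 2 \<longrightarrow> 0 \<le> \<sigma> \<longrightarrow>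
       (INF Qhat\<in>estimators T. SUP (M, Adv)\<in>huber_class \<sigma>.
          emeasure (data_law T \<epsilon> M Adv)
            {D \<in> space (data_law T \<epsilon> M Adv).
               c * \<sigma> * sqrt \<epsilon> / (1 - \<gamma>)
                 \<le> sup_dist M (Qhat (states M) (actions M) D) (optimal_Q \<gamma> M)})
       \<ge> 1 / 4)"
proof (intro exI[of _ "1 / 2"] conjI allI impI INF_greatest)
  show "(0::real) < 1 / 2" by simp
next
  fix T :: nat and \<gamma> \<epsilon> \<sigma> :: real and Qhat
  assume \<gamma>: "0 < \<gamma>" "\<gamma> < 1" and \<epsilon>: "0 \<le> \<epsilon>" "\<epsilon> < 1 / 2" and Qhat: "Qhat \<in> estimators T"
  define m where "m = \<sigma> / sqrt \<epsilon>" \<comment> \<open>equal to \<open>0\<close> if \<open>\<epsilon> = 0\<close>, where the claim is trivial\<close>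
  \<comment> \<open>\<open>b\<close> is half the gap between the two optimal values, which is where
    the constant 1/2 comes from.\<close>
  define b where "b = 1 / 2 * \<sigma> * sqrt \<epsilon> / (1 - \<gamma>)"
  define P where "P = (\<lambda>(M, Adv). emeasure (data_law T \<epsilon> M Adv)
    {D \<in> space (data_law T \<epsilon> M Adv).
       b \<le> sup_dist M (Qhat (states M) (actions M) D) (optimal_Q \<gamma> M)})"
  let ?M0 = "one_state_mdp (two_point m 0)" and ?A0 = "two_point m (1 - \<epsilon>)"
  let ?M1 = "one_state_mdp (two_point m \<epsilon>)" and ?A1 = "two_point m 0"
  define L where "L = data_law T \<epsilon> ?M0 ?A0"
  have L': "data_law T \<epsilon> ?M1 ?A1 = L"
    unfolding L_def using data_law_indistinguishable \<epsilon> by simp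
  \<comment> \<open>The second moments of the true rewards are 0 and
    \<open>m\<^sup>2 * \<epsilon>\<close>; the latter is at most \<open>\<sigma>\<^sup>2\<close> by
    the choice of \<open>m\<close>.\<close>
  have cls: "(?M0, ?A0) \<in> huber_class \<sigma>" "(?M1, ?A1) \<in> huber_class \<sigma>"
    using \<epsilon> by (auto intro!: two_point_in_huber_class real_distribution_two_point
        simp: m_def power_divide)
  interpret L: prob_space L
    unfolding L_def data_law_def
    by (intro prob_space_PiM prob_space_dataset_law finite_one_state_mdp real_distribution_two_point)
  let ?E0 = "{D \<in> space L. b \<le> sup_dist ?M0 (Qhat {0} {0} D) (optimal_Q \<gamma> ?M0)}"
  let ?E1 = "{D \<in> space L. b \<le> sup_dist ?M1 (Qhat {0} {0} D) (optimal_Q \<gamma> ?M1)}"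
  have E: "?E0 \<in> sets L" "?E1 \<in> sets L"
    using error_event_measurable[OF cls(1) Qhat, of \<epsilon>]
      error_event_measurable[OF cls(2) Qhat, of \<epsilon>] by (simp_all add: L' flip: L_def)
  have Q0: "optimal_Q \<gamma> ?M0 (0, 0) = 0"
    using \<gamma> by (simp add: optimal_Q_one_state real_distribution_two_point integral_two_point)
  \<comment> \<open>This grouping avoids a case split:
    \<open>\<epsilon> / sqrt \<epsilon> = sqrt \<epsilon>\<close> also holds at 0, where division by
    0 yields 0.\<close>
  have "\<epsilon> * m = \<sigma> * (\<epsilon> / sqrt \<epsilon>)"
    by (simp add: m_def)
  then have "\<epsilon> * m = \<sigma> * sqrt \<epsilon>"
    using \<epsilon> by (simp only: real_div_sqrt)
  then have Q1: "optimal_Q \<gamma> ?M1 (0, 0) = 2 * b"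
    using \<gamma> \<epsilon> by (simp add: optimal_Q_one_state real_distribution_two_point integral_two_point b_def
        divide_simps)
  \<comment> \<open>By the triangle inequality no number is closer than \<open>b\<close> to both 0
    and \<open>2 * b\<close>.\<close>
  have "space L \<subseteq> ?E0 \<union> ?E1"
    by (auto simp: sup_dist_one_state Q0 Q1)
  then have "ennreal (1 / 2) \<le> P (?M0, ?A0) \<or> ennreal (1 / 2) \<le> P (?M1, ?A1)"
    using L.half_le_emeasure_of_cover[OF E] by (simp add: P_def L' flip: L_def)
  then have "ennreal (1 / 2) \<le> (SUP x\<in>huber_class \<sigma>. P x)"
    using cls by (meson SUP_upper2)
  \<comment> \<open>The argument gives 1/2, more than the claimed 1/4; the quotient in
    \<open>ennreal\<close> is first identified with the real one.\<close>
  moreover have "(1 / 4 :: ennreal) = ennreal (1 / 4)"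
    by (simp add: ennreal_divide_numeral flip: ennreal_1)
  then have "(1 / 4 :: ennreal) \<le> ennreal (1 / 2)"
    by (simp only: ennreal_leI)
  ultimately show "1 / 4 \<le> (SUP (M, Adv)\<in>huber_class \<sigma>.
      emeasure (data_law T \<epsilon> M Adv)
        {D \<in> space (data_law T \<epsilon> M Adv).
           1 / 2 * \<sigma> * sqrt \<epsilon> / (1 - \<gamma>)
             \<le> sup_dist M (Qhat (states M) (actions M) D) (optimal_Q \<gamma> M)})"
    unfolding P_def b_def by (rule order_trans[rotated])
qed

end
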